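(* Let $X$ and $Y$ be real Banach spaces and let $U\colon X\to Y$ be a local isometry. Then $U$ is an isometry, that is, $U$ is surjective and $\lVert U(x)-U(x')\rVert=\lVert x-x'\rVert$ for all $x,x'\in X$.
   Context: All Banach spaces are over $\mathbb{R}$, and $\lVert\cdot\rVert$ denotes the norm of both $X$ and $Y$. No linearity of maps is assumed. A map $f$ from a subset $V\subseteq X$ to $Y$ is called isometric if $\lVert f(x)-f(x')\rVert=\lVert x-x'\rVert$ for all $x,x'\in V$; an isometry onto a set $W\subseteq Y$ is an isometric map $V\to Y$ with image exactly $W$. In particular, an isometry $X\to Y$ is a surjective isometric map. A map $f\colon X\to Y$ is a local isometry if every $x\in X$ has an open neighborhood $V\subseteq X$ such that $f|_V$ is an isometry onto an open subset of $Y$. *)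

theory Defs
  imports "HOL-Analysis.Analysis"
begin

definition isometric_on ::
    "'a::real_normed_vector set \<Rightarrow> ('a \<Rightarrow> 'b::real_normed_vector) \<Rightarrow> bool" where
  "isometric_on V f \<longleftrightarrow> (\<forall>x\<in>V. \<forall>x'\<in>V. norm (f x - f x') = norm (x - x'))"

definition isometry_onto ::
    "'a::real_normed_vector set \<Rightarrow> 'b::real_normed_vector set \<Rightarrow> ('a \<Rightarrow> 'b) \<Rightarrow> bool" where
  "isometry_onto V W f \<longleftrightarrow> isometric_on V f \<and> f ` V = W"

definition local_isometry ::
    "('a::real_normed_vector \<Rightarrow> 'b::real_normed_vector) \<Rightarrow> bool" where
  "local_isometry f \<longleftrightarrow>
     (\<forall>x. \<exists>V W. open V \<and> x \<in> V \<and> open W \<and> isometry_onto V W f)"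

end

(* On a small lens-shaped set, symmetric under the point reflection at the midpoint of a and b, the
   reflection argument for the Mazur-Ulam theorem works: if an isometry f moved the midpoint off
   the midpoint of the images, conjugating reflections by isometries would repeatedly double the
   defect, which is bounded. So a local isometry locally preserves midpoints. By a maximum
   principle along segments it is then affine on every segment, and both norm preservation
   and surjectivity follow by rescaling into small neighbourhoods. *)

theory Submission
  imports Defs
begin

section \<open>Isometries between subsets\<close>

lemma isometric_on_inj_on: "isometric_on V f \<Longrightarrow> inj_on f V"
  unfolding isometric_on_def inj_on_def by (metis eq_iff_diff_eq_0 norm_eq_zero)

lemma isometry_onto_compose:
  assumes "isometry_onto V W f" "isometry_onto W Z g"
  shows "isometry_onto V Z (g \<circ> f)"
  using assms unfolding isometry_onto_def isometric_on_def by (auto simp: image_comp)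

lemma isometry_onto_inv_into:
  assumes "isometry_onto V W f"
  shows "isometry_onto W V (inv_into V f)"
proof -
  have inj: "inj_on f V" and im: "f ` V = W"
    using assms isometric_on_inj_on by (auto simp: isometry_onto_def)
  have "inv_into V f ` W = V"
    using inj im by (metis inv_into_image_cancel order_refl)
  moreover have "isometric_on W (inv_into V f)"
    unfolding isometric_on_def
  proof (intro ballI)
    fix y y' assume "y \<in> W" "y' \<in> W"
    then have "inv_into V f y \<in> V" "inv_into V f y' \<in> V"
        "f (inv_into V f y) = y" "f (inv_into V f y') = y'"
      using im by (auto intro: inv_into_into f_inv_into_f)
    then show "norm (inv_into V f y - inv_into V f y') = norm (y - y')"
      using assms unfolding isometry_onto_def isometric_on_def by metis
  qed
  ultimately show ?thesis by (simp add: isometry_onto_def)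
qed

section \<open>The Mazur-Ulam argument on lenses\<close>

text \<open>Membership depends only on the distances to \<open>a\<close> and \<open>b\<close>, so a
  map that preserves these distances respects it. This bounded symmetric set stands in for the whole
  space of the Mazur-Ulam argument.\<close>

definition lens :: "'a::real_normed_vector \<Rightarrow> 'a \<Rightarrow> 'a set" where
  "lens a b = cball a (dist a b) \<inter> cball b (dist a b)"

lemma ends_in_lens: "a \<in> lens a b" "b \<in> lens a b"
  by (auto simp: lens_def dist_commute)

lemma midpoint_in_lens: "midpoint a b \<in> lens a b"
  by (auto simp: lens_def dist_midpoint)

text \<open>The reflection exchanges the distances to \<open>a\<close> and \<open>b\<close>, and it
  is its own inverse.\<close>

lemma isometry_onto_reflection:
  fixes a b :: "'a::real_normed_vector"
  shows "isometry_onto (lens a b) (lens a b) (\<lambda>z. a + b - z)"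
proof -
  have "a + b - z \<in> lens a b" if "z \<in> lens a b" for z
  proof -
    have "dist a (a + b - z) = dist b z" "dist b (a + b - z) = dist a z"
      by (simp_all add: dist_norm norm_minus_commute)
    with that show ?thesis by (auto simp: lens_def)
  qed
  then have "(\<lambda>z. a + b - z) ` lens a b = lens a b"
    by (auto intro!: image_eqI[where x = "a + b - z" for z])
  then show ?thesis
    by (simp add: isometry_onto_def isometric_on_def norm_minus_commute)
qed

text \<open>Describes the midpoint without division, which turns midpoint goals into equations that
  \<open>algebra_simps\<close> can settle.\<close>

lemma reflection_fixed_iff:
  fixes a b :: "'a::real_vector"
  shows "a + b - z = z \<longleftrightarrow> z = midpoint a b"
proof -
  have "a + b - z = z \<longleftrightarrow> 2 *\<^sub>R z = a + b"
    by (auto simp: scaleR_2 algebra_simps)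
  also have "\<dots> \<longleftrightarrow> inverse 2 *\<^sub>R 2 *\<^sub>R z = inverse 2 *\<^sub>R (a + b)"
    by (simp only: scaleR_cancel_left) simp
  also have "\<dots> \<longleftrightarrow> z = midpoint a b"
    by (simp add: midpoint_def)
  finally show ?thesis .
qed

text \<open>The factor 2 is the source of the doubling of the defect.\<close>

lemma dist_reflection:
  fixes a b :: "'a::real_normed_vector"
  shows "dist (a + b - z) z = 2 * dist z (midpoint a b)"
proof -
  have "a + b - z - z = (- 2) *\<^sub>R (z - midpoint a b)"
    by (simp add: midpoint_def algebra_simps scaleR_2)
  then show ?thesis by (simp add: dist_norm)
qed

text \<open>\<open>g\<close> is the reflection of the target lens conjugated by \<open>f\<close>. It
  moves \<open>midpoint a b\<close> as far as the reflection moves the image of that point, which is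
  twice the defect of \<open>f\<close>. The unordered pairs in \<open>ab\<close> admit both maps
  that keep the order of the endpoints and maps that swap them, as the iteration below
  needs.\<close>

lemma isometry_onto_conjugate_reflection:
  fixes a b :: "'a::real_normed_vector" and f :: "'a \<Rightarrow> 'b::real_normed_vector"
  assumes f: "isometry_onto (lens a b) (lens c d) f" and ab: "{f a, f b} = {c, d}"
  obtains g where "isometry_onto (lens a b) (lens a b) g" "g a = b" "g b = a"
    "dist (g (midpoint a b)) (midpoint a b) = 2 * dist (f (midpoint a b)) (midpoint c d)"
proof
  define g where "g = (\<lambda>z. inv_into (lens a b) f (c + d - f z))"
  let ?L = "lens a b" and ?m = "midpoint a b"
  have inj: "inj_on f ?L"
    using f isometric_on_inj_on by (auto simp: isometry_onto_def)
  have "g = inv_into ?L f \<circ> ((\<lambda>z. c + d - z) \<circ> f)" by (auto simp: g_def)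
  then show g: "isometry_onto ?L ?L g"
    using isometry_onto_compose[OF isometry_onto_compose[OF f isometry_onto_reflection]
        isometry_onto_inv_into[OF f]] by simp
  have fab: "c + d - f a = f b" "c + d - f b = f a"
    using ab by (auto simp: doubleton_eq_iff)
  show "g a = b" "g b = a"
    unfolding g_def fab by (rule inv_into_f_f[OF inj ends_in_lens(2)] inv_into_f_f[OF inj ends_in_lens(1)])+
  have fm: "f ?m \<in> lens c d"
    using f midpoint_in_lens by (auto simp: isometry_onto_def)
  then have "c + d - f ?m \<in> f ` ?L"
    using f isometry_onto_reflection[of c d] by (auto simp: isometry_onto_def)
  then have "f (g ?m) = c + d - f ?m" by (simp add: g_def f_inv_into_f)
  moreover have "g ?m \<in> ?L"
    using g midpoint_in_lens by (auto simp: isometry_onto_def)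
  ultimately have "dist (g ?m) ?m = dist (c + d - f ?m) (f ?m)"
    using f midpoint_in_lens unfolding isometry_onto_def isometric_on_def dist_norm by metis
  then show "dist (g ?m) ?m = 2 * dist (f ?m) (midpoint c d)"
    by (simp add: dist_reflection)
qed

text \<open>Conjugation turns a self-isometry swapping \<open>a\<close> and \<open>b\<close> into
  another one with twice the defect. Hence the induction runs over all such \<open>g\<close>, and
  the bound \<open>dist a b\<close> survives every doubling.\<close>

lemma swap_isometry_defect_bound:
  fixes a b :: "'a::real_normed_vector"
  assumes "isometry_onto (lens a b) (lens a b) g" "g a = b" "g b = a"
  shows "2 ^ n * dist (g (midpoint a b)) (midpoint a b) \<le> dist a b"
  using assms
proof (induction n arbitrary: g)
  case 0
  let ?m = "midpoint a b"
  \<comment> \<open>As \<open>g a = b\<close>, both \<open>g ?m\<close> and \<open>?m\<close> lie at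
    distance \<open>dist a b / 2\<close> from \<open>b\<close>.\<close>
  have "dist (g ?m) (g a) = dist ?m a"
    using 0 ends_in_lens midpoint_in_lens
    unfolding isometry_onto_def isometric_on_def dist_norm by blast
  then have "dist (g ?m) b = dist a b / 2" using 0 by (simp add: dist_midpoint)
  moreover have "dist b ?m = dist a b / 2" by (simp add: dist_midpoint)
  ultimately show ?case using dist_triangle[of "g ?m" ?m b] by simp
next
  case (Suc n)
  have "{g a, g b} = {a, b}" using Suc.prems by auto
  from isometry_onto_conjugate_reflection[OF Suc.prems(1) this]
  obtain h where h: "isometry_onto (lens a b) (lens a b) h" "h a = b" "h b = a"
    "dist (h (midpoint a b)) (midpoint a b) = 2 * dist (g (midpoint a b)) (midpoint a b)"
    by blast
  show ?case using Suc.IH[OF h(1-3)] h(4) by (simp add: mult_ac)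
qed

text \<open>One conjugation yields a self-isometry swapping the endpoints, with twice the defect of
  \<open>f\<close>; if positive, its doublings would outgrow \<open>dist a b\<close>.\<close>

lemma isometry_onto_lens_midpoint:
  fixes a b :: "'a::real_normed_vector" and f :: "'a \<Rightarrow> 'b::real_normed_vector"
  assumes f: "isometry_onto (lens a b) (lens (f a) (f b)) f"
  shows "f (midpoint a b) = midpoint (f a) (f b)"
proof -
  from isometry_onto_conjugate_reflection[OF f refl]
  obtain g where g: "isometry_onto (lens a b) (lens a b) g" "g a = b" "g b = a"
    "dist (g (midpoint a b)) (midpoint a b)
      = 2 * dist (f (midpoint a b)) (midpoint (f a) (f b))"
    by blast
  let ?d = "dist (g (midpoint a b)) (midpoint a b)"
  have "?d = 0"
  proof (rule ccontr)
    assume "?d \<noteq> 0"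
    then have pos: "?d > 0" by simp
    obtain n where "dist a b / ?d < 2 ^ n"
      using real_arch_pow[of 2 "dist a b / ?d"] by auto
    then have "dist a b < 2 ^ n * ?d" using pos by (simp add: pos_divide_less_eq)
    with swap_isometry_defect_bound[OF g(1-3), of n] show False by simp
  qed
  then show ?thesis using g(4) by simp
qed

section \<open>Local behaviour of a local isometry\<close>

lemma local_isometryE:
  assumes "local_isometry U"
  obtains R where "R > 0" "isometric_on (ball x R) U" "ball (U x) R \<subseteq> range U"
    "\<And>a b. a \<in> ball x R \<Longrightarrow> b \<in> ball x R \<Longrightarrow> U (midpoint a b) = midpoint (U a) (U b)"
proof -
  obtain V W where VW: "open V" "x \<in> V" "open W" "isometry_onto V W U"
    using assms unfolding local_isometry_def by blast
  have iso: "isometric_on V U" and im: "U ` V = W"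
    using VW(4) by (auto simp: isometry_onto_def)
  obtain r s where r: "r > 0" "ball x r \<subseteq> V" and s: "s > 0" "ball (U x) s \<subseteq> W"
    using VW im by (meson open_contains_ball imageI)
  \<comment> \<open>Points of \<open>ball x R\<close> are less than \<open>2 * R\<close> apart, so
    their lens stays within \<open>3 * R\<close> of \<open>x\<close>, and the lens of their images
    within \<open>3 * R\<close> of \<open>U x\<close>. The quarter keeps these inside
    \<open>V\<close> and \<open>W\<close>.\<close>
  define R where "R = min r s / 4"
  have "R > 0" and R4: "4 * R \<le> r" "4 * R \<le> s" using r s by (auto simp: R_def)
  have RV: "ball x R \<subseteq> V" using r R4 \<open>R > 0\<close> by (force simp: subset_iff)
  have "U (midpoint a b) = midpoint (U a) (U b)" if ab: "a \<in> ball x R" "b \<in> ball x R" for a b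
  proof (rule isometry_onto_lens_midpoint)
    have Udist: "dist (U y) (U z) = dist y z" if "y \<in> V" "z \<in> V" for y z
      using iso that by (simp add: isometric_on_def dist_norm)
    have abV: "a \<in> V" "b \<in> V" using ab RV by auto
    have dab: "dist a b < 2 * R"
      using ab dist_triangle[of a b x] by (simp add: dist_commute)
    have LV: "lens a b \<subseteq> V"
    proof
      fix z assume "z \<in> lens a b"
      then have "dist a z < 2 * R" using dab by (auto simp: lens_def)
      then have "dist x z < r"
        using ab dist_triangle[of x z a] R4 \<open>R > 0\<close> by simp
      then show "z \<in> V" using r by auto
    qed
    have LW: "lens (U a) (U b) \<subseteq> W"
    proof
      fix y assume "y \<in> lens (U a) (U b)"
      then have "dist (U a) y < 2 * R" using dab Udist[OF abV] by (auto simp: lens_def)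
      moreover have "dist (U x) (U a) < R" using ab Udist[OF VW(2) abV(1)] by simp
      ultimately have "dist (U x) y < s"
        using dist_triangle[of "U x" y "U a"] R4 \<open>R > 0\<close> by simp
      then show "y \<in> W" using s by auto
    qed
    have mem: "U z \<in> lens (U a) (U b) \<longleftrightarrow> z \<in> lens a b" if "z \<in> V" for z
      using that abV Udist by (simp add: lens_def)
    \<comment> \<open>Onto: a point of the image lens lies in \<open>W\<close>, hence is
      \<open>U z\<close> for some \<open>z\<close> in \<open>V\<close>, and \<open>mem\<close> puts
      \<open>z\<close> into the lens of \<open>a\<close> and \<open>b\<close>.\<close>
    have "U ` lens a b = lens (U a) (U b)"
      using mem LV LW im by blast
    then show "isometry_onto (lens a b) (lens (U a) (U b)) U"
      using iso LV unfolding isometry_onto_def isometric_on_def by blast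
  qed
  moreover have "isometric_on (ball x R) U"
    using iso RV unfolding isometric_on_def by blast
  moreover have "ball (U x) R \<subseteq> range U"
  proof -
    have "ball (U x) R \<subseteq> ball (U x) s" using R4 \<open>R > 0\<close> by (intro subset_ball) simp
    then show ?thesis using s im by blast
  qed
  ultimately show ?thesis using that \<open>R > 0\<close> by blast
qed

section \<open>From local midpoints to affinity on segments\<close>

text \<open>Maximum principle: the first point where the norm is maximal would be the midpoint of two
  points, one of which has strictly smaller norm.\<close>

lemma locally_midpoint_zero:
  fixes \<phi> :: "real \<Rightarrow> 'a::real_normed_vector"
  assumes cont: "continuous_on {0..1} \<phi>"
    and loc: "\<And>t. t \<in> {0<..<1} \<Longrightarrow> \<exists>r>0. \<forall>h. 0 < h \<longrightarrow> h < r \<longrightarrow> \<phi> t = midpoint (\<phi> (t - h)) (\<phi> (t + h))"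
    and ends: "\<phi> 0 = 0" "\<phi> 1 = 0" and "t \<in> {0..1}"
  shows "\<phi> t = 0"
proof (rule ccontr)
  assume "\<phi> t \<noteq> 0"
  have cn: "continuous_on {0..1} (\<lambda>t. norm (\<phi> t))" using cont by (intro continuous_intros)
  obtain m where m: "m \<in> {0..1}" "\<And>s. s \<in> {0..1} \<Longrightarrow> norm (\<phi> s) \<le> norm (\<phi> m)"
    using continuous_attains_sup[OF compact_Icc _ cn] by auto
  define M where "M = norm (\<phi> m)"
  have "M > 0" using m(2)[OF \<open>t \<in> {0..1}\<close>] \<open>\<phi> t \<noteq> 0\<close>
    by (metis M_def norm_le_zero_iff not_le order_trans)
  define S where "S = {s \<in> {0..1}. norm (\<phi> s) = M}"
  have "S = {0..1} \<inter> (\<lambda>t. norm (\<phi> t)) -` {M}" by (auto simp: S_def)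
  then have "closed S"
    using continuous_closed_preimage[OF cn closed_atLeastAtMost closed_singleton] by simp
  moreover have "bounded S" by (rule bounded_subset[of "{0..1}"]) (auto simp: S_def)
  ultimately have "compact S" by (simp add: compact_eq_bounded_closed)
  moreover have "S \<noteq> {}" using m(1) by (auto simp: S_def M_def)
  ultimately obtain p where p: "p \<in> S" "\<And>s. s \<in> S \<Longrightarrow> p \<le> s"
    using compact_attains_inf[of S] by metis
  have np: "norm (\<phi> p) = M" using p by (simp add: S_def)
  then have "p \<noteq> 0" "p \<noteq> 1" using \<open>M > 0\<close> ends by auto
  then have p01: "p \<in> {0<..<1}" using p(1) by (auto simp: S_def)
  from loc[OF this] obtain r where r: "r > 0"
    "\<And>h. 0 < h \<Longrightarrow> h < r \<Longrightarrow> \<phi> p = midpoint (\<phi> (p - h)) (\<phi> (p + h))" by blast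
  \<comment> \<open>\<open>r / 2\<close> gives the strict \<open>h < r\<close>; the other bounds
    keep \<open>p - h\<close> and \<open>p + h\<close> in the unit interval.\<close>
  define h where "h = min (r / 2) (min p (1 - p))"
  have h: "0 < h" "h < r" "p - h \<in> {0..1}" "p + h \<in> {0..1}"
    using r p01 by (auto simp: h_def)
  have "p - h \<notin> S" using p(2)[of "p - h"] h by auto
  then have "norm (\<phi> (p - h)) < M"
    using m(2)[OF h(3)] h(3) by (auto simp: S_def M_def)
  moreover have "norm (\<phi> (p + h)) \<le> M" using m(2)[OF h(4)] by (simp add: M_def)
  moreover have "norm (\<phi> p) = norm (\<phi> (p - h) + \<phi> (p + h)) / 2"
    using r(2)[OF h(1,2)] by (simp add: midpoint_def)
  ultimately show False using np norm_triangle_ineq[of "\<phi> (p - h)" "\<phi> (p + h)"] by simp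
qed

lemma local_isometry_continuous:
  assumes "local_isometry U"
  shows "continuous_on S U"
proof -
  have "isCont U x" for x
  proof -
    obtain R where R: "R > 0" "isometric_on (ball x R) U" using local_isometryE[OF assms] by metis
    have "dist (U y) (U x) < e" if "dist y x < min R e" for y e
      using that R unfolding isometric_on_def by (auto simp: dist_norm norm_minus_commute)
    then show ?thesis
      unfolding continuous_at_eps_delta using \<open>R > 0\<close> by (metis min_less_iff_conj)
  qed
  then show ?thesis by (simp add: continuous_at_imp_continuous_on)
qed

text \<open>The deviation \<open>\<phi>\<close> of \<open>U\<close> from its chord vanishes at both
  ends and inherits local midpoint preservation, since the chord is affine; the maximum principle
  makes it zero.\<close>

lemma local_isometry_affine_on_segment:
  fixes U :: "'a::real_normed_vector \<Rightarrow> 'b::real_normed_vector"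
  assumes U: "local_isometry U" and t: "t \<in> {0..1}"
  shows "U (x + t *\<^sub>R v) = U x + t *\<^sub>R (U (x + v) - U x)"
proof -
  define \<phi> where "\<phi> s = U (x + s *\<^sub>R v) - U x - s *\<^sub>R (U (x + v) - U x)" for s
  have "\<phi> t = 0"
  proof (rule locally_midpoint_zero[OF _ _ _ _ t])
    show "continuous_on {0..1} \<phi>"
      unfolding \<phi>_def
      by (intro continuous_intros continuous_on_compose2[OF local_isometry_continuous[OF U, of UNIV]])
        auto
    show "\<phi> 0 = 0" "\<phi> 1 = 0" by (simp_all add: \<phi>_def)
    fix p :: real
    obtain R where R: "R > 0" "\<And>a b. a \<in> ball (x + p *\<^sub>R v) R \<Longrightarrow> b \<in> ball (x + p *\<^sub>R v) R
        \<Longrightarrow> U (midpoint a b) = midpoint (U a) (U b)"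
      using local_isometryE[OF U] by metis
    \<comment> \<open>The \<open>+ 1\<close> keeps \<open>r\<close> positive also for
      \<open>v = 0\<close>, and \<open>h < r\<close> still gives
      \<open>h * norm v < R\<close>.\<close>
    define r where "r = R / (norm v + 1)"
    have v1: "norm v + 1 > 0" by (simp add: add_nonneg_pos)
    have "\<phi> p = midpoint (\<phi> (p - h)) (\<phi> (p + h))" if h: "0 < h" "h < r" for h
    proof -
      let ?a = "x + (p - h) *\<^sub>R v" and ?b = "x + (p + h) *\<^sub>R v"
      have "h * norm v < R"
      proof -
        have "h * (norm v + 1) < R" using h v1 by (simp add: r_def pos_less_divide_eq)
        then show ?thesis using h by (simp add: algebra_simps)
      qed
      then have "?a \<in> ball (x + p *\<^sub>R v) R" "?b \<in> ball (x + p *\<^sub>R v) R"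
        using h by (simp_all add: dist_norm algebra_simps)
      then have "U (midpoint ?a ?b) = midpoint (U ?a) (U ?b)" by (rule R(2))
      moreover have "midpoint ?a ?b = x + p *\<^sub>R v"
        by (simp add: eq_commute[of "midpoint _ _"] reflection_fixed_iff[symmetric] algebra_simps)
      ultimately have e: "U (x + p *\<^sub>R v) = midpoint (U ?a) (U ?b)" by simp
      have "U ?a + U ?b - U (x + p *\<^sub>R v) = U (x + p *\<^sub>R v)"
        using e by (simp only: reflection_fixed_iff)
      then show ?thesis
        unfolding reflection_fixed_iff[symmetric] \<phi>_def by (simp add: algebra_simps)
    qed
    moreover have "r > 0" using R(1) v1 by (simp add: r_def)
    ultimately show "\<exists>r>0. \<forall>h. 0 < h \<longrightarrow> h < r \<longrightarrow> \<phi> p = midpoint (\<phi> (p - h)) (\<phi> (p + h))"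
      by blast
  qed
  then show ?thesis by (simp add: \<phi>_def algebra_simps)
qed

section \<open>Rescaling to global statements\<close>

lemma obtain_small_scale:
  fixes v :: "'a::real_normed_vector"
  assumes "R > 0"
  obtains t where "0 < t" "t \<le> 1" "norm (t *\<^sub>R v) < R"
proof -
  \<comment> \<open>The cap \<open>1\<close> suits affinity on segments, which takes parameters in
    the unit interval; the quotient brings \<open>t *\<^sub>R v\<close> into the ball.\<close>
  define t where "t = min 1 (R / (norm v + 1))"
  have v1: "norm v + 1 > 0" by (simp add: add_nonneg_pos)
  have "t > 0" using assms v1 by (simp add: t_def)
  have "t * (norm v + 1) \<le> R"
    using v1 by (simp only: t_def pos_le_divide_eq[symmetric] min.cobounded2)
  then have "norm (t *\<^sub>R v) < R" using \<open>t > 0\<close> by (simp add: algebra_simps)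
  moreover have "t \<le> 1" by (simp add: t_def)
  ultimately show ?thesis using that \<open>t > 0\<close> by blast
qed

theorem theorem1p2:
  fixes U :: "'a::banach \<Rightarrow> 'b::banach"
  assumes "local_isometry U"
  shows "surj U \<and> (\<forall>x x'. norm (U x - U x') = norm (x - x'))"
proof (intro conjI allI)
  note affine = local_isometry_affine_on_segment[OF assms]
  show "norm (U x - U x') = norm (x - x')" for x x'
  proof -
    obtain R where R: "R > 0" "isometric_on (ball x R) U" using local_isometryE[OF assms] by metis
    obtain t where t: "0 < t" "t \<le> 1" "norm (t *\<^sub>R (x' - x)) < R"
      using obtain_small_scale[OF R(1)] by metis
    have "x + t *\<^sub>R (x' - x) \<in> ball x R" "x \<in> ball x R" using t R by (simp_all add: dist_norm)
    then have "norm (U (x + t *\<^sub>R (x' - x)) - U x) = norm (x + t *\<^sub>R (x' - x) - x)"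
      using R(2) unfolding isometric_on_def by blast
    \<comment> \<open>Affinity at parameter \<open>t\<close> carries the equality from the nearby
      point to \<open>x'\<close>; the factor \<open>t\<close> then cancels.\<close>
    then have "norm (t *\<^sub>R (U x' - U x)) = norm (t *\<^sub>R (x' - x))"
      using affine[of t x "x' - x"] t by simp
    then show ?thesis using t by (simp add: norm_minus_commute)
  qed
  show "surj U"
    unfolding surj_def
  proof
    fix y
    obtain R where R: "R > 0" "ball (U 0) R \<subseteq> range U" using local_isometryE[OF assms] by metis
    obtain t where t: "0 < t" "t \<le> 1" "norm (t *\<^sub>R (y - U 0)) < R"
      using obtain_small_scale[OF R(1)] by metis
    have "U 0 + t *\<^sub>R (y - U 0) \<in> ball (U 0) R" using t by (simp add: dist_norm)
    then obtain p where p: "U p = U 0 + t *\<^sub>R (y - U 0)" using R(2) by (metis imageE subsetD)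
    \<comment> \<open>\<open>p\<close> is the point at parameter \<open>t\<close> on the segment
      from \<open>0\<close> to \<open>inverse t *\<^sub>R p\<close>. Comparing with the choice of
      \<open>p\<close> and cancelling \<open>t\<close> shows that the far end is a preimage of
      \<open>y\<close>.\<close>
    have "U p = U 0 + t *\<^sub>R (U (inverse t *\<^sub>R p) - U 0)"
      using affine[of t 0 "inverse t *\<^sub>R p"] t by simp
    then have "y = U (inverse t *\<^sub>R p)" using p t by simp
    then show "\<exists>x. y = U x" ..
  qed
qed

end
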